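(* Let $\tilde A = A + E \in \mathbb{C}^{n\times n}$, where $A \in \mathbb{C}^{n \times n}$ is normal and $E \in \mathbb{C}^{n\times n}$. Let $\tilde U$ denote the unitary matrix returned by the algorithm RandDiag when applied to $\tilde A$ in exact arithmetic; that is, $\tilde U$ is a unitary matrix such that $\tilde U^*(\mu_H \tilde H + \mu_S\, \mathrm{i}\tilde S)\tilde U$ is diagonal, where $\tilde H = (\tilde A+\tilde A^* )/2$, $\tilde S = (\tilde A - \tilde A^* )/2$, and $\mu_H,\mu_S \sim \mathcal{N}(0,1)$ are independent. Then, for any $R > 1$, the inequality $$\|\operatorname{offdiag}(\tilde U^* \tilde A \tilde U)\|_F \le R\, \|E\|_F$$ holds with probability at least $1 - \frac{12}{\sqrt{\pi}}\, \frac{n^{3.5}}{R-1}$.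
   Context: $A^*$ denotes the Hermitian (conjugate) transpose of $A$; $A$ is normal if $AA^* = A^*A$; $\mathrm{i}$ is the imaginary unit; $\|\cdot\|_F$ is the Frobenius norm; $\operatorname{offdiag}(M)$ denotes the off-diagonal part of a square matrix $M$, obtained by setting its diagonal entries to zero. The algorithm RandDiag, for an input $B \in \mathbb{C}^{n\times n}$ (here not required to be normal), does the following: (1) compute $H = (B+B^* )/2$ and $S = (B-B^* )/2$ (so $H$ and $\mathrm{i}S$ are Hermitian); (2) draw two independent real standard normal random variables $\mu_H, \mu_S \sim \mathcal{N}(0,1)$; (3) compute and return a unitary matrix $U$ such that $U^*(\mu_H H + \mu_S\, \mathrm{i} S)U$ is diagonal. No particular choice of diagonalizing unitary matrix is prescribed in step (3); it may depend on the realized values of $\mu_H, \mu_S$. The matrices $A$ and $E$ are fixed (deterministic), and probability is with respect to $(\mu_H,\mu_S)$. *)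

theory Defs
  imports
    "HOL-Probability.Probability"
    "Jordan_Normal_Form.Schur_Decomposition"
begin

definition normal_mat :: "complex mat \<Rightarrow> bool" where
  "normal_mat A \<longleftrightarrow> A * mat_adjoint A = mat_adjoint A * A"

definition unitary_mat :: "complex mat \<Rightarrow> bool" where
  "unitary_mat U \<longleftrightarrow> square_mat U \<and>
     mat_adjoint U * U = 1\<^sub>m (dim_row U) \<and> U * mat_adjoint U = 1\<^sub>m (dim_row U)"

definition frobenius_norm :: "complex mat \<Rightarrow> real" where
  "frobenius_norm A = sqrt (\<Sum>i<dim_row A. \<Sum>j<dim_col A. (cmod (A $$ (i,j)))\<^sup>2)"

definition offdiag :: "complex mat \<Rightarrow> complex mat" where
  "offdiag A = mat (dim_row A) (dim_col A) (\<lambda>(i,j). if i = j then 0 else A $$ (i,j))"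

definition hermitian_part :: "complex mat \<Rightarrow> complex mat" where
  "hermitian_part B = (1/2) \<cdot>\<^sub>m (B + mat_adjoint B)"

definition skew_hermitian_part :: "complex mat \<Rightarrow> complex mat" where
  "skew_hermitian_part B = (1/2) \<cdot>\<^sub>m (B - mat_adjoint B)"

(* RandDiag leaves the choice of the diagonalizing unitary open, so it is modelled as a relation:
   U is an admissible output on input B when the Gaussian draws take the values h and s. *)
definition randdiag_output :: "complex mat \<Rightarrow> real \<Rightarrow> real \<Rightarrow> complex mat \<Rightarrow> bool" where
  "randdiag_output B h s U \<longleftrightarrow>
     dim_row U = dim_row B \<and> unitary_mat U \<and>
     diagonal_mat (mat_adjoint U *
       (complex_of_real h \<cdot>\<^sub>m hermitian_part B +
        complex_of_real s \<cdot>\<^sub>m (\<i> \<cdot>\<^sub>m skew_hermitian_part B)) * U)"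

(* The output may be chosen non-measurably in the random draws, so {x \<in> space M. P x} need not be
   an event. "With probability at least p" therefore means that P holds on some event of
   probability at least p. The lemma below shows that this is the usual meaning whenever
   {x \<in> space M. P x} is an event. *)
definition holds_with_prob_at_least :: "'a measure \<Rightarrow> real \<Rightarrow> ('a \<Rightarrow> bool) \<Rightarrow> bool" where
  "holds_with_prob_at_least M p P \<longleftrightarrow>
     (\<exists>G \<in> sets M. G \<subseteq> {x \<in> space M. P x} \<and> p \<le> measure M G)"

lemma (in prob_space) holds_with_prob_at_least_iff:
  assumes "{x \<in> space M. P x} \<in> events"
  shows "holds_with_prob_at_least M p P \<longleftrightarrow> p \<le> prob {x \<in> space M. P x}"
  unfolding holds_with_prob_at_least_def
  using assms finite_measure_mono[OF _ assms] by (blast intro: order_trans)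

end

theory Submission
  imports Defs "Jordan_Normal_Form.Spectral_Radius"
begin

text \<open>
  Write \<open>K(B) = h H + s \<i> S\<close>, where \<open>H\<close> and \<open>S\<close> are the Hermitian and skew-Hermitian parts of
  \<open>B\<close>, and diagonalize the normal matrix as \<open>A = V \<Lambda> V\<^sup>*\<close> with eigenvalues \<open>\<lambda>\<^sub>k\<close>. The same \<open>V\<close>
  diagonalizes \<open>K(A)\<close>, whose eigenvalues \<open>x\<^sub>k = h Re \<lambda>\<^sub>k - s Im \<lambda>\<^sub>k\<close> are the scalar products of the
  random vector \<open>\<mu> = (h, s)\<close> with the complex conjugates of \<open>\<lambda>\<^sub>k\<close>, seen as points of the plane. The
  passage from \<open>\<lambda>\<^sub>k\<close> to \<open>x\<^sub>k\<close> is called the projection below. The argument has a deterministic and a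
  probabilistic half.

  Deterministic half (lemma \<open>offdiag_randdiag_le\<close>). Let \<open>U\<close> diagonalize \<open>K(A + E) = K(A) + K(E)\<close>,
  with eigenvalues \<open>y\<^sub>j\<close>, and put \<open>W = V\<^sup>* U\<close>. The entries of \<open>V\<^sup>* K(E) U\<close> are
  \<open>(y\<^sub>j - x\<^sub>k) W\<^sub>k\<^sub>j\<close>, and its Frobenius norm is at most \<open>\<bar>\<mu>\<bar> \<parallel>E\<parallel>\<close>; so column \<open>j\<close> of \<open>W\<close>
  concentrates on the indices \<open>k\<close> with \<open>x\<^sub>k\<close> near \<open>y\<^sub>j\<close>. Let \<open>x\<^bsub>p j\<^esub>\<close> be a value nearest to
  \<open>y\<^sub>j\<close> among all \<open>x\<^sub>k\<close>. Then \<open>\<bar>x\<^sub>k - x\<^bsub>p j\<^esub>\<bar> \<le> 2 \<bar>y\<^sub>j - x\<^sub>k\<bar>\<close> for every \<open>k\<close>; this replaces a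
  one-to-one matching of the two spectra, since \<open>p\<close> may fail to be injective. If the projection
  multiplies the distance of any two distinct eigenvalues of \<open>A\<close> by more than \<open>c \<bar>\<mu>\<bar>\<close>, the matrix with
  entries \<open>(\<lambda>\<^sub>k - \<lambda>\<^bsub>p j\<^esub>) W\<^sub>k\<^sub>j\<close> has Frobenius norm at most \<open>(2 / c) \<parallel>E\<parallel>\<close>. This norm is
  the distance of \<open>U\<^sup>* A U\<close> to the diagonal matrix with entries \<open>\<lambda>\<^bsub>p j\<^esub>\<close>, hence a bound for its
  off-diagonal part; adding \<open>U\<^sup>* E U\<close> costs another \<open>\<parallel>E\<parallel>\<close>. The factor \<open>\<bar>\<mu>\<bar>\<close> has cancelled, and
  \<open>c = 2 / (R - 1)\<close> gives the constant \<open>R\<close>.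

  Probabilistic half (lemma \<open>prob_gaussian_small_angle\<close>). For a fixed pair of distinct eigenvalues, the
  factor by which the projection changes their distance is \<open>\<bar>\<mu>\<bar>\<close> times the absolute cosine of the angle
  between a fixed vector and the uniformly distributed direction of \<open>\<mu>\<close>. This cosine is at most \<open>c\<close>
  with probability \<open>O(c)\<close>. A union bound over the at most \<open>n (n - 1)\<close> ordered pairs gives a failure
  probability of \<open>O(n (n - 1) / (R - 1))\<close>. The claimed bound grows much faster with \<open>n\<close>, which leaves
  room for crude constants.
\<close>

section \<open>Adjoints and unitary matrices\<close>

lemma mat_adjoint_dim [simp]:
  "dim_row (mat_adjoint A) = dim_col A" "dim_col (mat_adjoint A) = dim_row A"
  by (auto simp: mat_adjoint_def)

lemma mat_adjoint_carrier [simp]: "A \<in> carrier_mat m n \<Longrightarrow> mat_adjoint A \<in> carrier_mat n m"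
  by (rule carrier_matI) auto

lemma mat_adjoint_index [simp]:
  fixes A :: "complex mat"
  assumes "i < dim_col A" "j < dim_row A"
  shows "mat_adjoint A $$ (i, j) = cnj (A $$ (j, i))"
  using assms by (simp add: mat_adjoint_def mat_of_rows_index)

lemma mult_mat_index:
  assumes "A \<in> carrier_mat m p" "B \<in> carrier_mat p q" "i < m" "j < q"
  shows "(A * B) $$ (i, j) = (\<Sum>k<p. A $$ (i, k) * B $$ (k, j))"
  using assms by (auto simp: scalar_prod_def atLeast0LessThan intro!: sum.cong)

lemma mat_adjoint_adjoint [simp]: "mat_adjoint (mat_adjoint A) = (A :: complex mat)"
  by (rule eq_matI) auto

lemma mat_adjoint_mult:
  fixes A B :: "complex mat"
  assumes A: "A \<in> carrier_mat m p" and B: "B \<in> carrier_mat p q"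
  shows "mat_adjoint (A * B) = mat_adjoint B * mat_adjoint A"
proof (rule eq_matI)
  fix i j assume "i < dim_row (mat_adjoint B * mat_adjoint A)" "j < dim_col (mat_adjoint B * mat_adjoint A)"
  then have ij: "i < q" "j < m" using A B by auto
  have "(mat_adjoint B * mat_adjoint A) $$ (i, j) = (\<Sum>k<p. mat_adjoint B $$ (i,k) * mat_adjoint A $$ (k,j))"
    by (rule mult_mat_index) (use A B ij in auto)
  also have "\<dots> = cnj (\<Sum>k<p. A $$ (j,k) * B $$ (k,i))"
    unfolding cnj_sum using A B ij by (intro sum.cong) (auto simp: mult.commute)
  also have "\<dots> = mat_adjoint (A * B) $$ (i, j)"
    using A B ij mult_mat_index[OF A B ij(2,1)] by simp
  finally show "mat_adjoint (A * B) $$ (i, j) = (mat_adjoint B * mat_adjoint A) $$ (i, j)" ..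
qed (use A B in auto)

lemma unitary_matI:
  assumes "U \<in> carrier_mat n n" "mat_adjoint U * U = 1\<^sub>m n"
  shows "unitary_mat U"
  using assms mat_mult_left_right_inverse[of "mat_adjoint U" n U]
  by (auto simp: unitary_mat_def)

lemma unitary_matD:
  assumes "unitary_mat U" "U \<in> carrier_mat n n"
  shows "mat_adjoint U * U = 1\<^sub>m n" "U * mat_adjoint U = 1\<^sub>m n"
  using assms by (auto simp: unitary_mat_def)

lemma unitary_mat_adjoint:
  assumes "unitary_mat U" shows "unitary_mat (mat_adjoint U)"
  using assms by (auto simp: unitary_mat_def)

lemma unitary_mat_mult:
  assumes U: "unitary_mat U" "U \<in> carrier_mat n n" and V: "unitary_mat V" "V \<in> carrier_mat n n"
  shows "unitary_mat (U * V)"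
proof (rule unitary_matI)
  have "mat_adjoint (U * V) * (U * V) = mat_adjoint V * ((mat_adjoint U * U) * V)"
    using U V by (simp add: mat_adjoint_mult[of _ n n _ n] assoc_mult_mat[of _ n n _ n _ n] mult_carrier_mat[of _ n n _ n])
  then show "mat_adjoint (U * V) * (U * V) = 1\<^sub>m n"
    using U V unitary_matD[OF U] unitary_matD[OF V] by simp
qed (use U V in auto)

lemma unitary_conj_mult:
  fixes U :: "complex mat"
  assumes U: "unitary_mat U" "U \<in> carrier_mat n n" and A: "A \<in> carrier_mat n n" and B: "B \<in> carrier_mat n n"
  shows "mat_adjoint U * (A * B) * U = (mat_adjoint U * A * U) * (mat_adjoint U * B * U)"
proof -
  have "(mat_adjoint U * A * U) * (mat_adjoint U * B * U)
      = mat_adjoint U * (A * ((U * mat_adjoint U) * (B * U)))"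
    using U A B by (simp add: assoc_mult_mat[of _ n n _ n _ n] mult_carrier_mat[of _ n n _ n])
  then show ?thesis
    using U A B by (simp add: unitary_matD(2)[OF U] assoc_mult_mat[of _ n n _ n _ n] mult_carrier_mat[of _ n n _ n])
qed

lemma adjoint_conj:
  fixes U :: "complex mat"
  assumes U: "U \<in> carrier_mat n n" and A: "A \<in> carrier_mat n n"
  shows "mat_adjoint (mat_adjoint U * A * U) = mat_adjoint U * mat_adjoint A * U"
  using U A by (simp add: mat_adjoint_mult[of _ n n _ n] assoc_mult_mat[of _ n n _ n _ n] mult_carrier_mat[of _ n n _ n])

lemma normal_mat_unitary_conj:
  assumes U: "unitary_mat U" "U \<in> carrier_mat n n" and A: "A \<in> carrier_mat n n" "normal_mat A"
  shows "normal_mat (mat_adjoint U * A * U)"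
  using A unitary_conj_mult[OF U A(1) mat_adjoint_carrier[OF A(1)]]
    unitary_conj_mult[OF U mat_adjoint_carrier[OF A(1)] A(1)]
  by (simp add: normal_mat_def adjoint_conj[OF U(2) A(1)])

section \<open>Unitary diagonalization of normal matrices\<close>

text \<open>
  Deflation step: an eigenvector is extended to a basis, which Gram-Schmidt makes orthogonal. The
  vectors produced there have arbitrary lengths, so they are normalized here to get a unitary matrix.
\<close>

lemma unitary_with_eigenvector_column:
  fixes A :: "complex mat"
  assumes A: "A \<in> carrier_mat (Suc m) (Suc m)"
  obtains W e where "unitary_mat W" "W \<in> carrier_mat (Suc m) (Suc m)"
    "\<And>i. i < Suc m \<Longrightarrow> (mat_adjoint W * A * W) $$ (i, 0) = (if i = 0 then e else 0)"
proof -
  let ?n = "Suc m"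
  obtain e where "eigenvalue A e"
    using spectrum_non_empty[OF A] by (auto simp: spectrum_def)
  then obtain v where "eigenvector A v e" by (auto simp: eigenvalue_def)
  then have v: "v \<in> carrier_vec ?n" and v0: "v \<noteq> 0\<^sub>v ?n" and Av: "A *\<^sub>v v = e \<cdot>\<^sub>v v"
    using A by (auto simp: eigenvector_def)
  interpret cof_vec_space ?n "TYPE(complex)" .
  define b where "b = basis_completion v"
  define ws where "ws = gram_schmidt ?n b"
  note bc = basis_completion[OF v v0, folded b_def]
  from bc(6,7) obtain vs where bv: "b = v # vs" by (cases b) auto
  note gs = gram_schmidt_result[OF bc(2,4,5) ws_def]
  have hdws: "hd ws = v" using gram_schmidt_hd[OF v, of vs] by (simp add: ws_def bv)
  have len: "length ws = ?n" using gs(4) bc(6) by simp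
  have ws0: "ws ! 0 = v" using hdws len by (cases ws) auto
  have wsc: "ws ! j \<in> carrier_vec ?n" if "j < ?n" for j using gs(3) len that by auto
  \<comment> \<open>the lengths of the orthogonal basis vectors\<close>
  define s where "s j = sqrt (\<Sum>i<?n. (cmod (ws ! j $ i))\<^sup>2)" for j
  define W where "W = mat ?n ?n (\<lambda>(i,j). ws ! j $ i / s j)"
  have W: "W \<in> carrier_mat ?n ?n" by (simp add: W_def)
  have inner: "(\<Sum>k<?n. cnj (ws ! i $ k) * ws ! j $ k) = (if i = j then (s j)\<^sup>2 else 0)"
    if ij: "i < ?n" "j < ?n" for i j
  proof (cases "i = j")
    case True
    have "(s j)\<^sup>2 = (\<Sum>k<?n. (cmod (ws ! j $ k))\<^sup>2)"
      by (simp add: s_def sum_nonneg del: sum.lessThan_Suc)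
    then have "complex_of_real ((s j)\<^sup>2) = (\<Sum>k<?n. ws ! j $ k * cnj (ws ! j $ k))"
      by (simp only: of_real_sum complex_norm_square)
    then show ?thesis using True by (simp only: mult.commute of_real_power simp_thms if_True)
  next
    case False
    have "ws ! j \<bullet>c ws ! i = 0"
      using corthogonalD[OF gs(2)] ij len False by metis
    moreover have "ws ! j \<bullet>c ws ! i = (\<Sum>k<?n. cnj (ws ! i $ k) * ws ! j $ k)"
      using carrier_vecD[OF wsc[OF ij(1)]] unfolding scalar_prod_def atLeast0LessThan
      by (intro sum.cong) auto
    ultimately show ?thesis using False by simp
  qed
  have s0: "s j \<noteq> 0" if j: "j < ?n" for j
  proof
    assume "s j = 0"
    then have "(\<Sum>k<?n. (cmod (ws ! j $ k))\<^sup>2) = 0" by (simp add: s_def del: sum.lessThan_Suc)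
    then have "ws ! j $ k = 0" if "k < ?n" for k
      using that by (subst (asm) sum_nonneg_eq_0_iff) auto
    then have "ws ! j \<bullet>c ws ! j = 0"
      using wsc[OF j] by (simp add: scalar_prod_def)
    then show False using corthogonalD[OF gs(2), of j j] j len by auto
  qed
  have WW: "mat_adjoint W * W = 1\<^sub>m ?n"
  proof (rule eq_matI)
    fix i j assume "i < dim_row (1\<^sub>m ?n)" "j < dim_col (1\<^sub>m ?n)"
    then have ij: "i < ?n" "j < ?n" by auto
    have "(mat_adjoint W * W) $$ (i,j) = (\<Sum>k<?n. mat_adjoint W $$ (i,k) * W $$ (k,j))"
      by (rule mult_mat_index) (use W ij in auto)
    also have "\<dots> = (\<Sum>k<?n. cnj (ws ! i $ k) * ws ! j $ k / (s i * s j))"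
      using ij by (intro sum.cong) (auto simp: W_def)
    also have "\<dots> = (\<Sum>k<?n. cnj (ws ! i $ k) * ws ! j $ k) / (s i * s j)"
      by (rule sum_divide_distrib[symmetric])
    also have "\<dots> = 1\<^sub>m ?n $$ (i,j)"
      using ij s0[of j] by (simp only: inner) (simp add: power2_eq_square)
    finally show "(mat_adjoint W * W) $$ (i,j) = 1\<^sub>m ?n $$ (i,j)" .
  qed (use W in auto)
  have uW: "unitary_mat W" by (rule unitary_matI[OF W WW])
  have AW: "(A * W) $$ (i, 0) = e * W $$ (i, 0)" if i: "i < ?n" for i
  proof -
    have "(A * W) $$ (i, 0) = (\<Sum>k<?n. A $$ (i,k) * W $$ (k,0))"
      by (rule mult_mat_index[OF A W i]) simp
    also have "\<dots> = (\<Sum>k<?n. A $$ (i,k) * v $ k / s 0)"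
      by (intro sum.cong) (auto simp: W_def ws0)
    also have "\<dots> = (\<Sum>k<?n. A $$ (i,k) * v $ k) / s 0"
      by (rule sum_divide_distrib[symmetric])
    also have "(\<Sum>k<?n. A $$ (i,k) * v $ k) = (A *\<^sub>v v) $ i"
      using A v i by (auto simp: scalar_prod_def atLeast0LessThan simp del: sum.op_ivl_Suc intro!: sum.cong)
    also have "\<dots> = e * v $ i" using Av i v by simp
    finally show ?thesis using i by (simp add: W_def ws0)
  qed
  have "(mat_adjoint W * A * W) $$ (i, 0) = (if i = 0 then e else 0)" if i: "i < ?n" for i
  proof -
    have "(mat_adjoint W * A * W) $$ (i, 0) = (mat_adjoint W * (A * W)) $$ (i, 0)"
      using A W by (simp add: assoc_mult_mat[of _ ?n ?n _ ?n _ ?n] mult_carrier_mat[of _ ?n ?n _ ?n])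
    also have "\<dots> = (\<Sum>k<?n. mat_adjoint W $$ (i,k) * (A * W) $$ (k,0))"
      by (rule mult_mat_index) (use A W i in auto)
    also have "\<dots> = (\<Sum>k<?n. e * (mat_adjoint W $$ (i,k) * W $$ (k,0)))"
      by (intro sum.cong) (auto simp: AW simp del: index_mult_mat)
    also have "\<dots> = e * (\<Sum>k<?n. mat_adjoint W $$ (i,k) * W $$ (k,0))"
      by (rule sum_distrib_left[symmetric])
    also have "(\<Sum>k<?n. mat_adjoint W $$ (i,k) * W $$ (k,0)) = (mat_adjoint W * W) $$ (i,0)"
      by (rule mult_mat_index[symmetric]) (use W i in auto)
    finally show ?thesis using i by (simp add: WW)
  qed
  with uW W show thesis by (rule that)
qed

text \<open>
  For a normal matrix, the first row and the first column have the same Euclidean norm, because these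
  norms are the corner entries of \<open>A A\<^sup>*\<close> and \<open>A\<^sup>* A\<close>. If the column is concentrated in the corner,
  nothing is left for the rest of the row.
\<close>

lemma normal_mat_first_row_zero:
  assumes A: "A \<in> carrier_mat (Suc m) (Suc m)" and n: "normal_mat A"
    and col: "\<And>i. 0 < i \<Longrightarrow> i < Suc m \<Longrightarrow> A $$ (i, 0) = 0"
    and j: "0 < j" "j < Suc m"
  shows "A $$ (0, j) = 0"
proof -
  let ?n = "Suc m"
  have "(\<Sum>k<?n. cnj (A $$ (k,0)) * A $$ (k,0)) = (mat_adjoint A * A) $$ (0,0)"
    using A by (subst mult_mat_index[of _ ?n ?n _ ?n]) auto
  also have "\<dots> = (A * mat_adjoint A) $$ (0,0)" using n by (simp add: normal_mat_def)
  also have "\<dots> = (\<Sum>k<?n. A $$ (0,k) * cnj (A $$ (0,k)))"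
    using A by (subst mult_mat_index[of _ ?n ?n _ ?n]) auto
  finally have "(\<Sum>k<m. A $$ (0,Suc k) * cnj (A $$ (0,Suc k))) = 0"
    using col by (simp add: sum.lessThan_Suc_shift del: sum.lessThan_Suc)
  then have "complex_of_real (\<Sum>k<m. (cmod (A $$ (0,Suc k)))\<^sup>2) = 0"
    by (simp only: of_real_sum complex_norm_square)
  then have "(\<Sum>k<m. (cmod (A $$ (0,Suc k)))\<^sup>2) = 0" by (simp only: of_real_eq_0_iff)
  then have "\<forall>k<m. A $$ (0, Suc k) = 0"
    by (subst (asm) sum_nonneg_eq_0_iff) auto
  then show ?thesis using j by (cases j) auto
qed

lemma mat_adjoint_four_block:
  fixes A :: "complex mat"
  assumes "A \<in> carrier_mat a b" "B \<in> carrier_mat a d" "C \<in> carrier_mat c b" "D \<in> carrier_mat c d"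
  shows "mat_adjoint (four_block_mat A B C D)
    = four_block_mat (mat_adjoint A) (mat_adjoint C) (mat_adjoint B) (mat_adjoint D)"
  using assms by (intro eq_matI) (auto simp: Let_def)

text \<open>
  After one deflation step the first column, and by normality also the first row, vanishes off the
  corner. The remaining block is again normal, and the induction proceeds with it.
\<close>

theorem normal_mat_unitarily_diagonalizable:
  assumes "A \<in> carrier_mat n n" "normal_mat A"
  obtains V where "unitary_mat V" "V \<in> carrier_mat n n" "diagonal_mat (mat_adjoint V * A * V)"
proof -
  have "\<exists>V. unitary_mat V \<and> V \<in> carrier_mat n n \<and> diagonal_mat (mat_adjoint V * A * V)"
    using assms
  proof (induction n arbitrary: A)
    case 0
    then show ?case
      by (intro exI[of _ "1\<^sub>m 0"]) (auto simp: unitary_mat_def diagonal_mat_def)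
  next
    case (Suc m)
    let ?n = "Suc m"
    obtain W e where W: "unitary_mat W" "W \<in> carrier_mat ?n ?n"
      and We: "\<And>i. i < ?n \<Longrightarrow> (mat_adjoint W * A * W) $$ (i, 0) = (if i = 0 then e else 0)"
      using unitary_with_eigenvector_column[OF Suc.prems(1)] by blast
    define A' where "A' = mat_adjoint W * A * W"
    have A': "A' \<in> carrier_mat ?n ?n" using W Suc.prems by (simp add: A'_def mult_carrier_mat[of _ ?n ?n _ ?n])
    have n': "normal_mat A'" unfolding A'_def by (rule normal_mat_unitary_conj[OF W Suc.prems])
    have c0: "A' $$ (i, 0) = (if i = 0 then e else 0)" if "i < ?n" for i
      using We[OF that] by (simp add: A'_def)
    have r0: "A' $$ (0, j) = 0" if "0 < j" "j < ?n" for j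
      by (rule normal_mat_first_row_zero[OF A' n' _ that]) (simp add: c0)
    define B where "B = mat m m (\<lambda>(i,j). A' $$ (Suc i, Suc j))"
    have B: "B \<in> carrier_mat m m" by (simp add: B_def)
    have Bi: "B $$ (i,j) = A' $$ (Suc i, Suc j)" if "i < m" "j < m" for i j
      using that by (simp add: B_def)
    have "normal_mat B"
      unfolding normal_mat_def
    proof (rule eq_matI)
      fix i j assume "i < dim_row (mat_adjoint B * B)" "j < dim_col (mat_adjoint B * B)"
      then have ij: "i < m" "j < m" using B by auto
      have "(B * mat_adjoint B) $$ (i,j) = (\<Sum>k<m. B $$ (i,k) * cnj (B $$ (j,k)))"
        using B ij by (subst mult_mat_index[of _ m m _ m]) auto
      also have "\<dots> = (\<Sum>k<?n. A' $$ (Suc i,k) * cnj (A' $$ (Suc j,k)))"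
        using ij by (simp add: sum.lessThan_Suc_shift Bi c0 del: sum.lessThan_Suc)
      also have "\<dots> = (A' * mat_adjoint A') $$ (Suc i, Suc j)"
        using A' ij by (subst mult_mat_index[of _ ?n ?n _ ?n]) auto
      also have "\<dots> = (mat_adjoint A' * A') $$ (Suc i, Suc j)"
        using n' by (simp add: normal_mat_def)
      also have "\<dots> = (\<Sum>k<?n. cnj (A' $$ (k, Suc i)) * A' $$ (k, Suc j))"
        using A' ij by (subst mult_mat_index[of _ ?n ?n _ ?n]) auto
      also have "\<dots> = (\<Sum>k<m. cnj (B $$ (k,i)) * B $$ (k,j))"
        using ij by (simp add: sum.lessThan_Suc_shift Bi r0 del: sum.lessThan_Suc)
      also have "\<dots> = (mat_adjoint B * B) $$ (i,j)"
        using B ij by (subst mult_mat_index[of _ m m _ m]) auto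
      finally show "(B * mat_adjoint B) $$ (i,j) = (mat_adjoint B * B) $$ (i,j)" .
    qed (use B in auto)
    from Suc.IH[OF B this] obtain V where V: "unitary_mat V" "V \<in> carrier_mat m m"
      and dV: "diagonal_mat (mat_adjoint V * B * V)" by blast
    let ?E = "mat 1 1 (\<lambda>_. e)"
    have A'blk: "A' = four_block_mat ?E (0\<^sub>m 1 m) (0\<^sub>m m 1) B"
      using A' by (intro eq_matI) (auto simp: B_def c0 r0 Let_def)
    define P where "P = four_block_mat (1\<^sub>m 1) (0\<^sub>m 1 m) (0\<^sub>m m 1) V"
    have P: "P \<in> carrier_mat ?n ?n" using V unfolding P_def by (intro carrier_matI) auto
    have one: "mat_adjoint (1\<^sub>m k) = (1\<^sub>m k :: complex mat)" for k by (intro eq_matI) auto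
    have zero: "mat_adjoint (0\<^sub>m k l) = (0\<^sub>m l k :: complex mat)" for k l by (intro eq_matI) auto
    have Padj: "mat_adjoint P = four_block_mat (1\<^sub>m 1) (0\<^sub>m 1 m) (0\<^sub>m m 1) (mat_adjoint V)"
      unfolding P_def using V by (subst mat_adjoint_four_block[of _ 1 1 _ m _ m]) (auto simp: one zero)
    have "mat_adjoint P * P = 1\<^sub>m ?n"
      unfolding Padj unfolding P_def using V
      by (subst mult_four_block_mat[of _ 1 1 _ m _ m _ _ 1 _ m])
         (auto simp: unitary_matD[OF V] simp del: One_nat_def)
    then have uP: "unitary_mat P" by (rule unitary_matI[OF P])
    have PA: "mat_adjoint P * A' * P = four_block_mat ?E (0\<^sub>m 1 m) (0\<^sub>m m 1) (mat_adjoint V * B * V)"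
      unfolding Padj A'blk unfolding P_def using V B
      by (subst mult_four_block_mat[of _ 1 1 _ m _ m _ _ 1 _ m],
          simp_all add: mult_carrier_mat[of _ m m _ m])+
    have "mat_adjoint (W * P) * A * (W * P) = mat_adjoint P * A' * P"
      using W P Suc.prems unfolding A'_def
      by (simp add: mat_adjoint_mult[of _ ?n ?n _ ?n] assoc_mult_mat[of _ ?n ?n _ ?n _ ?n] mult_carrier_mat[of _ ?n ?n _ ?n])
    moreover have "diagonal_mat (mat_adjoint P * A' * P)"
      using dV V B unfolding PA by (auto simp: diagonal_mat_def Let_def)
    ultimately show ?case
      using unitary_mat_mult[OF W uP P] W P
      by (intro exI[of _ "W * P"]) simp
  qed
  then show thesis using that by blast
qed

section \<open>The direction of a standard Gaussian vector in the plane\<close>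

lemma std_normal_interval_le:
  assumes "0 \<le> r"
  shows "emeasure (density lborel std_normal_density) {m - r .. m + r} \<le> ennreal (2 * r / sqrt (2 * pi))"
proof -
  have "emeasure (density lborel std_normal_density) {m - r .. m + r}
      = (\<integral>\<^sup>+x. ennreal (std_normal_density x) * indicator {m - r .. m + r} x \<partial>lborel)"
    by (simp add: emeasure_density)
  also have "\<dots> \<le> (\<integral>\<^sup>+x. ennreal (1 / sqrt (2 * pi)) * indicator {m - r .. m + r} x \<partial>lborel)"
    by (intro nn_integral_mono mult_right_mono ennreal_leI) (auto simp: std_normal_density_def field_simps)
  also have "\<dots> = ennreal (1 / sqrt (2 * pi)) * ennreal (2 * r)"
    using assms by (simp add: nn_integral_cmult)
  finally show ?thesis
    using assms by (simp add: ennreal_mult'[symmetric])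
qed

lemma nn_integral_std_normal_abs:
  "(\<integral>\<^sup>+x. ennreal \<bar>x\<bar> \<partial>density lborel std_normal_density) = ennreal (sqrt (2 / pi))"
proof -
  have "(\<integral>\<^sup>+x. ennreal \<bar>x\<bar> \<partial>density lborel std_normal_density)
      = (\<integral>\<^sup>+x. ennreal (std_normal_density x * \<bar>x\<bar>) \<partial>lborel)"
    by (simp add: nn_integral_density ennreal_mult)
  also have "\<dots> = ennreal (sqrt (2 / pi))"
    using std_normal_moment_abs_odd[of 0]
    by (subst nn_integral_eq_integral) (auto simp: has_bochner_integral_iff)
  finally show ?thesis .
qed

text \<open>
  For fixed second coordinate \<open>s\<close>, the double cone of vectors \<open>(h, s)\<close> nearly orthogonal to
  \<open>(v\<^sub>1, v\<^sub>2)\<close> is cut in an interval of length \<open>O(c \<bar>s\<bar>)\<close>. The assumption \<open>\<bar>v\<^sub>2\<bar> \<le> \<bar>v\<^sub>1\<bar>\<close> keeps the axis of the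
  cone away from the horizontal, so that \<open>\<bar>h\<bar>\<close> is controlled by \<open>\<bar>s\<bar>\<close>.
\<close>

lemma small_angle_subset_interval:
  fixes v\<^sub>1 v\<^sub>2 c h s :: real
  assumes v: "\<bar>v\<^sub>2\<bar> \<le> \<bar>v\<^sub>1\<bar>" and c: "0 \<le> c" "c \<le> 1/4"
    and v1: "v\<^sub>1 \<noteq> 0"
    and small: "\<bar>h * v\<^sub>1 + s * v\<^sub>2\<bar> \<le> c * sqrt (h\<^sup>2 + s\<^sup>2) * sqrt (v\<^sub>1\<^sup>2 + v\<^sub>2\<^sup>2)"
  shows "\<bar>h + s * (v\<^sub>2 / v\<^sub>1)\<bar> \<le> 5 * c * \<bar>s\<bar>"
proof -
  define w where "w = v\<^sub>2 / v\<^sub>1"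
  have w: "\<bar>w\<bar> \<le> 1" using v v1 by (simp add: w_def)
  have hs: "sqrt (h\<^sup>2 + s\<^sup>2) \<le> \<bar>h\<bar> + \<bar>s\<bar>" by (rule sqrt_sum_squares_le_sum_abs)
  \<comment> \<open>crude constants: \<open>3/2\<close> for \<open>sqrt 2\<close>, and \<open>\<bar>h\<bar> + \<bar>s\<bar> \<le> 10/3 \<bar>s\<bar>\<close> inside the cone\<close>
  have "sqrt (v\<^sub>1\<^sup>2 + v\<^sub>2\<^sup>2) \<le> 3/2 * \<bar>v\<^sub>1\<bar>"
  proof (rule real_le_lsqrt)
    have "v\<^sub>2\<^sup>2 \<le> v\<^sub>1\<^sup>2" using v by (simp add: abs_le_square_iff)
    moreover have "(3/2 * \<bar>v\<^sub>1\<bar>)\<^sup>2 = 9/4 * v\<^sub>1\<^sup>2" by (simp add: power2_eq_square)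
    ultimately show "v\<^sub>1\<^sup>2 + v\<^sub>2\<^sup>2 \<le> (3/2 * \<bar>v\<^sub>1\<bar>)\<^sup>2"
      using zero_le_power2[of v\<^sub>1] by linarith
  qed simp
  then have "c * sqrt (h\<^sup>2 + s\<^sup>2) * sqrt (v\<^sub>1\<^sup>2 + v\<^sub>2\<^sup>2) \<le> c * (\<bar>h\<bar> + \<bar>s\<bar>) * (3/2 * \<bar>v\<^sub>1\<bar>)"
    using hs c by (intro mult_mono) auto
  moreover have "h * v\<^sub>1 + s * v\<^sub>2 = (h + s * w) * v\<^sub>1" using v1 by (simp add: w_def field_simps)
  ultimately have "\<bar>h + s * w\<bar> * \<bar>v\<^sub>1\<bar> \<le> (3/2 * c * (\<bar>h\<bar> + \<bar>s\<bar>)) * \<bar>v\<^sub>1\<bar>"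
    using small by (simp add: abs_mult mult_ac)
  then have le: "\<bar>h + s * w\<bar> \<le> 3/2 * c * (\<bar>h\<bar> + \<bar>s\<bar>)"
    using v1 by (simp add: mult_le_cancel_right)
  have "\<bar>h\<bar> \<le> \<bar>h + s * w\<bar> + \<bar>s * w\<bar>" by linarith
  moreover have "3/2 * c * (\<bar>h\<bar> + \<bar>s\<bar>) \<le> 3/8 * (\<bar>h\<bar> + \<bar>s\<bar>)"
    using c by (intro mult_right_mono) auto
  moreover have "\<bar>s * w\<bar> \<le> \<bar>s\<bar>" using w by (simp add: abs_mult mult_left_le)
  ultimately have "3/2 * (\<bar>h\<bar> + \<bar>s\<bar>) \<le> 5 * \<bar>s\<bar>" 
    using le abs_ge_zero[of s] by argo
  then have "c * (3/2 * (\<bar>h\<bar> + \<bar>s\<bar>)) \<le> c * (5 * \<bar>s\<bar>)" using c(1) by (rule mult_left_mono)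
  then show ?thesis using le by (simp add: w_def mult_ac)
qed

lemma (in prob_space) distr_borel_std_normal:
  assumes "distributed M lborel X std_normal_density"
  shows "distr M borel X = density lborel std_normal_density"
proof -
  have "distr M borel X = distr M lborel X" by (rule distr_cong) simp_all
  then show ?thesis using assms by (simp add: distributed_def)
qed

lemma (in prob_space) indep_var_sym:
  assumes "indep_var S X T Y" shows "indep_var T Y S X"
proof -
  have "indep_set B A" if "indep_set A B" for A B
    using that unfolding indep_sets2_eq
  proof (intro conjI ballI; elim conjE)
    fix b a assume "b \<in> B" "a \<in> A" "\<forall>a\<in>A. \<forall>b\<in>B. prob (a \<inter> b) = prob a * prob b"
    then have "prob (a \<inter> b) = prob a * prob b" by blast
    then show "prob (b \<inter> a) = prob b * prob a" by (simp add: Int_commute mult.commute)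
  qed
  then show ?thesis using assms unfolding indep_var_eq by blast
qed

text \<open>
  Slice along the second coordinate: on each slice the Gaussian measure of the interval is its length
  times the maximum \<open>1 / sqrt (2 \<pi>)\<close> of the density, and integrating the length \<open>10 c \<bar>s\<bar>\<close> over \<open>s\<close>
  brings in the first absolute moment \<open>sqrt (2 / \<pi>)\<close>. The result is \<open>10 c / \<pi> \<le> 4 c\<close>.
\<close>

lemma (in prob_space) prob_gaussian_small_angle_aux:
  assumes X: "distributed M lborel X std_normal_density"
    and Y: "distributed M lborel Y std_normal_density"
    and ind: "indep_var borel X borel Y"
    and v: "\<bar>v\<^sub>2\<bar> \<le> \<bar>v\<^sub>1\<bar>" "v\<^sub>1 \<noteq> 0" and c: "0 \<le> c"
  shows "prob {\<omega> \<in> space M. \<bar>X \<omega> * v\<^sub>1 + Y \<omega> * v\<^sub>2\<bar>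
      \<le> c * sqrt ((X \<omega>)\<^sup>2 + (Y \<omega>)\<^sup>2) * sqrt (v\<^sub>1\<^sup>2 + v\<^sub>2\<^sup>2)} \<le> 4 * c"
proof (cases "c \<le> 1/4")
  case False
  then have "1 \<le> 4 * c" by simp
  then show ?thesis by (rule order_trans[OF prob_le_1])
next
  case True
  let ?N = "density lborel std_normal_density"
  interpret N: prob_space ?N by (rule prob_space_normal_density) simp
  interpret NN: pair_sigma_finite ?N ?N ..
  have [measurable]: "X \<in> borel_measurable M" "Y \<in> borel_measurable M"
    using X Y by (auto dest!: distributed_measurable)
  define Q where "Q = {p :: real \<times> real. \<bar>fst p * v\<^sub>1 + snd p * v\<^sub>2\<bar>
      \<le> c * sqrt ((fst p)\<^sup>2 + (snd p)\<^sup>2) * sqrt (v\<^sub>1\<^sup>2 + v\<^sub>2\<^sup>2)}"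
  have Q [measurable]: "Q \<in> sets (borel \<Otimes>\<^sub>M borel)"
  proof -
    have "{p \<in> space (borel \<Otimes>\<^sub>M borel). \<bar>fst p * v\<^sub>1 + snd p * v\<^sub>2\<bar>
      \<le> c * sqrt ((fst p)\<^sup>2 + (snd p)\<^sup>2) * sqrt (v\<^sub>1\<^sup>2 + v\<^sub>2\<^sup>2)} \<in> sets (borel \<Otimes>\<^sub>M borel)"
      by measurable
    then show ?thesis by (simp add: Q_def space_pair_measure)
  qed
  have "sets (?N \<Otimes>\<^sub>M ?N) = sets (borel \<Otimes>\<^sub>M borel :: (real \<times> real) measure)"
    by (rule sets_pair_measure_cong) simp_all
  with Q have Q': "Q \<in> sets (?N \<Otimes>\<^sub>M ?N)" by blast
  have joint: "distr M (borel \<Otimes>\<^sub>M borel) (\<lambda>\<omega>. (X \<omega>, Y \<omega>)) = ?N \<Otimes>\<^sub>M ?N"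
    using ind[unfolded indep_var_distribution_eq] distr_borel_std_normal[OF X] distr_borel_std_normal[OF Y]
    by simp
  have "emeasure M {\<omega> \<in> space M. \<bar>X \<omega> * v\<^sub>1 + Y \<omega> * v\<^sub>2\<bar>
      \<le> c * sqrt ((X \<omega>)\<^sup>2 + (Y \<omega>)\<^sup>2) * sqrt (v\<^sub>1\<^sup>2 + v\<^sub>2\<^sup>2)}
      = emeasure (distr M (borel \<Otimes>\<^sub>M borel) (\<lambda>\<omega>. (X \<omega>, Y \<omega>))) Q"
    using Q by (subst emeasure_distr) (auto simp: Q_def intro!: arg_cong[where f="emeasure M"])
  also have "\<dots> = (\<integral>\<^sup>+s. emeasure ?N ((\<lambda>h. (h, s)) -` Q) \<partial>?N)"
    unfolding joint by (rule NN.emeasure_pair_measure_alt2[OF Q'])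
  also have "\<dots> \<le> (\<integral>\<^sup>+s. ennreal (10 * c / sqrt (2 * pi)) * ennreal \<bar>s\<bar> \<partial>?N)"
  proof (intro nn_integral_mono)
    fix s :: real
    let ?m = "- (s * (v\<^sub>2 / v\<^sub>1))" and ?r = "5 * c * \<bar>s\<bar>"
    have "h \<in> {?m - ?r .. ?m + ?r}" if "(h, s) \<in> Q" for h
      using small_angle_subset_interval[OF v(1) c True v(2), of h s] that by (auto simp: Q_def abs_le_iff)
    then have "emeasure ?N ((\<lambda>h. (h, s)) -` Q) \<le> emeasure ?N {?m - ?r .. ?m + ?r}"
      by (intro emeasure_mono) auto
    also have "\<dots> \<le> ennreal (2 * ?r / sqrt (2 * pi))"
      by (rule std_normal_interval_le) (use c in simp)
    also have "\<dots> = ennreal (10 * c / sqrt (2 * pi)) * ennreal \<bar>s\<bar>"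
      using c by (simp add: ennreal_mult'[symmetric])
    finally show "emeasure ?N ((\<lambda>h. (h, s)) -` Q) \<le> ennreal (10 * c / sqrt (2 * pi)) * ennreal \<bar>s\<bar>" .
  qed
  also have "\<dots> = ennreal (10 * c / sqrt (2 * pi)) * ennreal (sqrt (2 / pi))"
    by (subst nn_integral_cmult) (auto simp: nn_integral_std_normal_abs)
  also have "\<dots> = ennreal (10 * c / sqrt (2 * pi) * sqrt (2 / pi))"
    using c by (simp add: ennreal_mult'[symmetric])
  also have "10 * c / sqrt (2 * pi) * sqrt (2 / pi) = 10 * c / pi"
    by (simp add: real_sqrt_mult real_sqrt_divide)
  also have "ennreal (10 * c / pi) \<le> ennreal (4 * c)"
  proof (rule ennreal_leI)
    have "10 * c \<le> 4 * c * pi" using mult_left_mono[OF less_imp_le[OF pi_gt3], of "4 * c"] c by simp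
    then show "10 * c / pi \<le> 4 * c" by (simp add: field_simps)
  qed
  finally show ?thesis using c by (simp add: emeasure_eq_measure)
qed

text \<open>
  One of the two coordinates of \<open>v\<close> dominates. By symmetry it may be taken to be the first, so that
  the slices run along the coordinate with the larger coefficient.
\<close>

lemma (in prob_space) prob_gaussian_small_angle:
  assumes X: "distributed M lborel X std_normal_density"
    and Y: "distributed M lborel Y std_normal_density"
    and ind: "indep_var borel X borel Y" and v: "v\<^sub>1 \<noteq> 0 \<or> v\<^sub>2 \<noteq> 0" and c: "0 \<le> c"
  shows "prob {\<omega> \<in> space M. \<bar>X \<omega> * v\<^sub>1 + Y \<omega> * v\<^sub>2\<bar>
      \<le> c * sqrt ((X \<omega>)\<^sup>2 + (Y \<omega>)\<^sup>2) * sqrt (v\<^sub>1\<^sup>2 + v\<^sub>2\<^sup>2)} \<le> 4 * c"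
proof (cases "\<bar>v\<^sub>2\<bar> \<le> \<bar>v\<^sub>1\<bar>")
  case True
  moreover from this v have "v\<^sub>1 \<noteq> 0" by auto
  ultimately show ?thesis by (rule prob_gaussian_small_angle_aux[OF X Y ind _ _ c])
next
  case False
  then have "\<bar>v\<^sub>1\<bar> \<le> \<bar>v\<^sub>2\<bar>" "v\<^sub>2 \<noteq> 0" by auto
  from prob_gaussian_small_angle_aux[OF Y X indep_var_sym[OF ind] this c]
  show ?thesis by (simp add: add.commute)
qed

section \<open>The Frobenius norm\<close>

lemma frobenius_norm_L2_set:
  assumes "A \<in> carrier_mat m n"
  shows "frobenius_norm A = L2_set (\<lambda>p. cmod (A $$ p)) ({..<m} \<times> {..<n})"
  using assms by (simp add: frobenius_norm_def L2_set_def sum.cartesian_product)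

lemma frobenius_norm_nonneg [simp]: "0 \<le> frobenius_norm A"
  by (simp add: frobenius_norm_def sum_nonneg)

lemma frobenius_norm_add_le:
  assumes "A \<in> carrier_mat m n" "B \<in> carrier_mat m n"
  shows "frobenius_norm (A + B) \<le> frobenius_norm A + frobenius_norm B"
proof -
  let ?I = "{..<m} \<times> {..<n}"
  have "frobenius_norm (A + B) = L2_set (\<lambda>p. cmod ((A + B) $$ p)) ?I"
    by (rule frobenius_norm_L2_set) (use assms in simp)
  also have "\<dots> \<le> L2_set (\<lambda>p. cmod (A $$ p) + cmod (B $$ p)) ?I"
    using assms by (intro L2_set_mono) (auto intro: norm_triangle_ineq)
  also have "\<dots> \<le> frobenius_norm A + frobenius_norm B"
    using assms by (simp add: frobenius_norm_L2_set L2_set_triangle_ineq)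
  finally show ?thesis .
qed

lemma frobenius_norm_le_mult:
  assumes A: "A \<in> carrier_mat m n" and B: "B \<in> carrier_mat m n" and c: "0 \<le> c"
    and le: "\<And>i j. i < m \<Longrightarrow> j < n \<Longrightarrow> cmod (A $$ (i, j)) \<le> c * cmod (B $$ (i, j))"
  shows "frobenius_norm A \<le> c * frobenius_norm B"
  unfolding frobenius_norm_L2_set[OF A] frobenius_norm_L2_set[OF B] L2_set_right_distrib[OF c]
  by (rule L2_set_mono) (auto intro: le)

lemma frobenius_norm_smult_le:
  "frobenius_norm (a \<cdot>\<^sub>m A) \<le> cmod a * frobenius_norm A"
  by (rule frobenius_norm_le_mult[of _ "dim_row A" "dim_col A"]) (auto simp: norm_mult)

lemma frobenius_norm_adjoint [simp]: "frobenius_norm (mat_adjoint A) = frobenius_norm A"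
  unfolding frobenius_norm_def by (subst sum.swap) simp

text \<open>
  The squared norm depends on \<open>A\<^sup>* A\<close> only, from which a unitary factor on the left of \<open>A\<close> cancels.
\<close>

lemma frobenius_norm_trace:
  assumes A: "A \<in> carrier_mat m n"
  shows "complex_of_real ((frobenius_norm A)\<^sup>2) = (\<Sum>j<n. (mat_adjoint A * A) $$ (j, j))"
proof -
  have "(mat_adjoint A * A) $$ (j, j) = complex_of_real (\<Sum>i<m. (cmod (A $$ (i, j)))\<^sup>2)" if "j < n" for j
  proof -
    have "(mat_adjoint A * A) $$ (j, j) = (\<Sum>i<m. A $$ (i, j) * cnj (A $$ (i, j)))"
      using A that by (subst mult_mat_index[of _ n m _ n]) (auto simp: mult.commute)
    then show ?thesis by (simp only: of_real_sum complex_norm_square)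
  qed
  moreover have "(frobenius_norm A)\<^sup>2 = (\<Sum>j<n. \<Sum>i<m. (cmod (A $$ (i, j)))\<^sup>2)"
    using A by (subst sum.swap) (simp add: frobenius_norm_def sum_nonneg)
  ultimately show ?thesis by simp
qed

lemma frobenius_norm_unitary_mult:
  assumes U: "unitary_mat U" "U \<in> carrier_mat n n" and A: "A \<in> carrier_mat n n"
  shows "frobenius_norm (U * A) = frobenius_norm A"
proof -
  have "mat_adjoint (U * A) * (U * A) = mat_adjoint A * ((mat_adjoint U * U) * A)"
    using U A by (simp add: mat_adjoint_mult[of _ n n _ n] assoc_mult_mat[of _ n n _ n _ n] mult_carrier_mat[of _ n n _ n])
  also have "\<dots> = mat_adjoint A * A" using A by (simp add: unitary_matD(1)[OF U])
  finally have "complex_of_real ((frobenius_norm (U * A))\<^sup>2) = complex_of_real ((frobenius_norm A)\<^sup>2)"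
    using frobenius_norm_trace[OF A] frobenius_norm_trace[OF mult_carrier_mat[OF U(2) A]] by simp
  then have "(frobenius_norm (U * A))\<^sup>2 = (frobenius_norm A)\<^sup>2" by (simp only: of_real_eq_iff)
  then show ?thesis by (simp add: power2_eq_iff_nonneg)
qed

lemma frobenius_norm_mult_unitary:
  assumes U: "unitary_mat U" "U \<in> carrier_mat n n" and A: "A \<in> carrier_mat n n"
  shows "frobenius_norm (A * U) = frobenius_norm A"
proof -
  have "frobenius_norm (A * U) = frobenius_norm (mat_adjoint U * mat_adjoint A)"
    using mat_adjoint_mult[OF A U(2)] frobenius_norm_adjoint[of "A * U"] by simp
  also have "\<dots> = frobenius_norm A"
    using frobenius_norm_unitary_mult[OF unitary_mat_adjoint[OF U(1)], of n "mat_adjoint A"] U A by simp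
  finally show ?thesis .
qed

lemma frobenius_norm_offdiag_le:
  assumes N: "N \<in> carrier_mat n n" and D: "D \<in> carrier_mat n n" "diagonal_mat D"
  shows "frobenius_norm (offdiag N) \<le> frobenius_norm (N - D)"
proof -
  have "frobenius_norm (offdiag N) \<le> 1 * frobenius_norm (N - D)"
    using N D by (intro frobenius_norm_le_mult[of _ n n]) (auto simp: offdiag_def diagonal_mat_def)
  then show ?thesis by simp
qed

lemma diagonal_mat_mult_index:
  assumes D: "D \<in> carrier_mat n n" "diagonal_mat D" and A: "A \<in> carrier_mat n n" and ij: "i < n" "j < n"
  shows "(D * A) $$ (i, j) = D $$ (i, i) * A $$ (i, j)"
proof -
  have "(D * A) $$ (i, j) = (\<Sum>k<n. D $$ (i, k) * A $$ (k, j))"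
    by (rule mult_mat_index) (use D A ij in auto)
  also have "\<dots> = (\<Sum>k<n. if k = i then D $$ (i, i) * A $$ (i, j) else 0)"
    using D ij by (intro sum.cong) (auto simp: diagonal_mat_def)
  finally show ?thesis using ij by simp
qed

lemma mult_diagonal_mat_index:
  assumes D: "D \<in> carrier_mat n n" "diagonal_mat D" and A: "A \<in> carrier_mat n n" and ij: "i < n" "j < n"
  shows "(A * D) $$ (i, j) = A $$ (i, j) * D $$ (j, j)"
proof -
  have "(A * D) $$ (i, j) = (\<Sum>k<n. A $$ (i, k) * D $$ (k, j))"
    by (rule mult_mat_index) (use D A ij in auto)
  also have "\<dots> = (\<Sum>k<n. if k = j then A $$ (i, j) * D $$ (j, j) else 0)"
    using D ij by (intro sum.cong) (auto simp: diagonal_mat_def)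
  finally show ?thesis using ij by simp
qed

section \<open>Real combinations of the Hermitian parts\<close>

text \<open>This is the matrix that RandDiag diagonalizes when the Gaussian draws are \<open>h\<close> and \<open>s\<close>.\<close>

definition hermitian_combination :: "real \<Rightarrow> real \<Rightarrow> complex mat \<Rightarrow> complex mat" where
  "hermitian_combination h s B =
    (complex_of_real h \<cdot>\<^sub>m hermitian_part B +
     complex_of_real s \<cdot>\<^sub>m (\<i> \<cdot>\<^sub>m skew_hermitian_part B))"

text \<open>
  As a combination of \<open>B\<close> and \<open>B\<^sup>*\<close> with conjugate coefficients of modulus \<open>sqrt (h\<^sup>2 + s\<^sup>2) / 2\<close>, the
  matrix makes the unitary equivariance and the norm bound below immediate.
\<close>

lemma hermitian_combination_eq:
  assumes B: "B \<in> carrier_mat n n"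
  shows "hermitian_combination h s B = (Complex h s / 2) \<cdot>\<^sub>m B + (Complex h (- s) / 2) \<cdot>\<^sub>m mat_adjoint B"
proof (rule eq_matI)
  fix i j assume "i < dim_row ((Complex h s / 2) \<cdot>\<^sub>m B + (Complex h (- s) / 2) \<cdot>\<^sub>m mat_adjoint B)"
    "j < dim_col ((Complex h s / 2) \<cdot>\<^sub>m B + (Complex h (- s) / 2) \<cdot>\<^sub>m mat_adjoint B)"
  then show "hermitian_combination h s B $$ (i, j)
      = ((Complex h s / 2) \<cdot>\<^sub>m B + (Complex h (- s) / 2) \<cdot>\<^sub>m mat_adjoint B) $$ (i, j)"
    using B
    by (simp add: hermitian_combination_def hermitian_part_def skew_hermitian_part_def
        Complex_eq field_simps)
qed (use B in \<open>simp_all add: hermitian_combination_def hermitian_part_def skew_hermitian_part_def\<close>)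

lemma hermitian_combination_carrier [simp]:
  assumes "B \<in> carrier_mat n n" shows "hermitian_combination h s B \<in> carrier_mat n n"
  using assms by (simp add: hermitian_combination_eq)

lemma hermitian_combination_add:
  assumes A: "A \<in> carrier_mat n n" and B: "B \<in> carrier_mat n n"
  shows "hermitian_combination h s (A + B) = hermitian_combination h s A + hermitian_combination h s B"
  using A B unfolding hermitian_combination_eq[OF A] hermitian_combination_eq[OF B]
    hermitian_combination_eq[OF add_carrier_mat[OF B]]
  by (intro eq_matI) (auto simp: field_simps)

lemma hermitian_combination_unitary_conj:
  assumes V: "V \<in> carrier_mat n n" and B: "B \<in> carrier_mat n n"
  shows "mat_adjoint V * hermitian_combination h s B * V = hermitian_combination h s (mat_adjoint V * B * V)"
proof -
  let ?a = "Complex h s / 2" and ?b = "Complex h (- s) / 2"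
  have c: "mat_adjoint V * B * V \<in> carrier_mat n n" "mat_adjoint V \<in> carrier_mat n n"
    "mat_adjoint B \<in> carrier_mat n n" "mat_adjoint V * B \<in> carrier_mat n n"
    "mat_adjoint V * mat_adjoint B \<in> carrier_mat n n"
    using V B by (simp_all add: mult_carrier_mat[of _ n n _ n])
  have "mat_adjoint V * (?a \<cdot>\<^sub>m B + ?b \<cdot>\<^sub>m mat_adjoint B) * V
      = (?a \<cdot>\<^sub>m (mat_adjoint V * B) + ?b \<cdot>\<^sub>m (mat_adjoint V * mat_adjoint B)) * V"
    using V B c by (subst mult_add_distrib_mat[of _ n n _ n]) (simp_all add: mult_smult_distrib[of _ n n _ n])
  also have "\<dots> = ?a \<cdot>\<^sub>m (mat_adjoint V * B * V) + ?b \<cdot>\<^sub>m (mat_adjoint V * mat_adjoint B * V)"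
    using V B c by (subst add_mult_distrib_mat[of _ n n _ _ n]) (simp_all add: mult_smult_assoc_mat[of _ n n _ n])
  finally show ?thesis
    unfolding hermitian_combination_eq[OF B] hermitian_combination_eq[OF c(1)] adjoint_conj[OF V B] .
qed

lemma frobenius_norm_hermitian_combination_le:
  assumes B: "B \<in> carrier_mat n n"
  shows "frobenius_norm (hermitian_combination h s B) \<le> sqrt (h\<^sup>2 + s\<^sup>2) * frobenius_norm B"
proof -
  have "frobenius_norm (hermitian_combination h s B)
      \<le> frobenius_norm ((Complex h s / 2) \<cdot>\<^sub>m B) + frobenius_norm ((Complex h (- s) / 2) \<cdot>\<^sub>m mat_adjoint B)"
    unfolding hermitian_combination_eq[OF B] by (rule frobenius_norm_add_le[of _ n n]) (use B in simp_all)
  also have "\<dots> \<le> cmod (Complex h s / 2) * frobenius_norm B + cmod (Complex h (- s) / 2) * frobenius_norm B"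
    using frobenius_norm_smult_le[of "Complex h s / 2" B] frobenius_norm_smult_le[of "Complex h (- s) / 2" "mat_adjoint B"]
    by simp
  also have "\<dots> = sqrt (h\<^sup>2 + s\<^sup>2) * frobenius_norm B"
    by (simp add: norm_divide complex_norm)
  finally show ?thesis .
qed

lemma hermitian_combination_diagonal:
  assumes L: "L \<in> carrier_mat n n" "diagonal_mat L"
  shows "diagonal_mat (hermitian_combination h s L)"
    and "i < n \<Longrightarrow> hermitian_combination h s L $$ (i, i) = complex_of_real (h * Re (L $$ (i, i)) - s * Im (L $$ (i, i)))"
  using L unfolding hermitian_combination_eq[OF L(1)]
  by (auto simp: diagonal_mat_def complex_eq_iff field_simps)

section \<open>Off-diagonal part for well separated projections\<close>

text \<open>
  The condition \<open>gap\<close> is relative: a pair of close eigenvalues only needs a proportionally small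
  separation after projection by \<open>z \<mapsto> h Re z - s Im z\<close>. This suffices because mixing eigenvectors of
  close eigenvalues of \<open>A\<close> does little harm, and it makes the bound free of the spectral gap and of the
  norm of \<open>A\<close>. The inequality is strict, so that it excludes \<open>h = s = 0\<close> as soon as there are two
  distinct eigenvalues.
\<close>

lemma offdiag_randdiag_le:
  fixes A E U V :: "complex mat" and h s c :: real
  assumes A: "A \<in> carrier_mat n n" and E: "E \<in> carrier_mat n n"
    and V: "unitary_mat V" "V \<in> carrier_mat n n" and L: "L = mat_adjoint V * A * V" "diagonal_mat L"
    and out: "randdiag_output (A + E) h s U" and c: "0 < c"
    and gap: "\<And>k l. k < n \<Longrightarrow> l < n \<Longrightarrow> L $$ (k, k) \<noteq> L $$ (l, l) \<Longrightarrow>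
       c * sqrt (h\<^sup>2 + s\<^sup>2) * cmod (L $$ (k, k) - L $$ (l, l))
       < \<bar>h * Re (L $$ (k, k) - L $$ (l, l)) - s * Im (L $$ (k, k) - L $$ (l, l))\<bar>"
  shows "frobenius_norm (offdiag (mat_adjoint U * (A + E) * U)) \<le> (1 + 2 / c) * frobenius_norm E"
proof -
  let ?K = "hermitian_combination h s" and ?r = "sqrt (h\<^sup>2 + s\<^sup>2)"
  note simps = minus_carrier_mat left_mult_one_mat[of _ n n] assoc_mult_mat[of _ n n _ n _ n] mult_carrier_mat[of _ n n _ n]
  define Y where "Y = mat_adjoint U * ?K (A + E) * U"
  have U: "unitary_mat U" "U \<in> carrier_mat n n" and dY: "diagonal_mat Y"
    using out A E by (auto simp: randdiag_output_def Y_def hermitian_combination_def unitary_mat_def)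
  have AE: "A + E \<in> carrier_mat n n" using E by simp
  have cY: "Y \<in> carrier_mat n n" and cL: "L \<in> carrier_mat n n"
    using U V A AE by (simp_all add: Y_def L simps)
  define W where "W = mat_adjoint V * U"
  have uW: "unitary_mat W" unfolding W_def
    by (rule unitary_mat_mult[OF unitary_mat_adjoint[OF V(1)] _ U]) (use V in simp)
  have cW: "W \<in> carrier_mat n n" using U V by (simp add: W_def simps)
  define lam where "lam k = L $$ (k, k)" for k
  define x where "x k = h * Re (lam k) - s * Im (lam k)" for k
  define y where "y j = Y $$ (j, j)" for j

  \<comment> \<open>the perturbation, read in the eigenbasis of \<open>A\<close> on the left and of the perturbed matrix on the right\<close>
  define G where "G = mat_adjoint V * ?K E * U"
  have cG: "G \<in> carrier_mat n n" using U V E by (simp add: G_def simps)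
  have "W * Y = mat_adjoint V * ((U * mat_adjoint U) * (?K (A + E) * U))"
    using U V AE by (simp add: W_def Y_def simps)
  also have "\<dots> = mat_adjoint V * ((?K A + ?K E) * U)"
    using U V A E AE by (simp add: unitary_matD(2)[OF U] simps hermitian_combination_add)
  also have "\<dots> = mat_adjoint V * (?K A * U) + mat_adjoint V * (?K E * U)"
    using U V A E by (simp add: add_mult_distrib_mat[of _ n n _ _ n] mult_add_distrib_mat[of _ n n _ n] simps)
  also have "mat_adjoint V * (?K A * U) = mat_adjoint V * (?K A * ((V * mat_adjoint V) * U))"
    using U V A by (simp add: unitary_matD(2)[OF V])
  also have "\<dots> = (mat_adjoint V * ?K A * V) * W"
    using U V A by (simp add: W_def simps)
  also have "mat_adjoint V * ?K A * V = ?K L"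
    unfolding L by (rule hermitian_combination_unitary_conj[OF V(2) A])
  also have "mat_adjoint V * (?K E * U) = G"
    using U V E by (simp add: G_def simps)
  finally have WY: "W * Y = ?K L * W + G" .
  have G: "G $$ (k, j) = (y j - x k) * W $$ (k, j)" if kj: "k < n" "j < n" for k j
  proof -
    have "(W * Y) $$ (k, j) = (?K L * W + G) $$ (k, j)" using WY by simp
    also have "\<dots> = (?K L * W) $$ (k, j) + G $$ (k, j)" using kj cG by simp
    finally show ?thesis
      using mult_diagonal_mat_index[OF cY dY cW kj]
        diagonal_mat_mult_index[OF hermitian_combination_carrier[OF cL] hermitian_combination_diagonal(1)[OF cL L(2)] cW kj]
        hermitian_combination_diagonal(2)[OF cL L(2) kj(1)]
      by (simp add: y_def x_def lam_def algebra_simps del: index_mult_mat)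
  qed
  have "frobenius_norm G = frobenius_norm (?K E)"
    unfolding G_def using U V E
    by (simp add: frobenius_norm_mult_unitary[of _ n] frobenius_norm_unitary_mult[of _ n] unitary_mat_adjoint simps)
  then have normG: "frobenius_norm G \<le> ?r * frobenius_norm E"
    using frobenius_norm_hermitian_combination_le[OF E, of h s] by simp

  have "\<exists>p<n. \<forall>k<n. cmod (y j - x p) \<le> cmod (y j - x k)" if "j < n" for j
  proof -
    have "\<exists>p. is_arg_min (\<lambda>k. cmod (y j - x k)) (\<lambda>k. k \<in> {..<n}) p"
      using that by (intro ex_is_arg_min_if_finite) auto
    then show ?thesis by (auto simp: is_arg_min_linorder)
  qed
  then obtain p where p: "\<And>j. j < n \<Longrightarrow> p j < n"
    and p_min: "\<And>j k. j < n \<Longrightarrow> k < n \<Longrightarrow> cmod (y j - x (p j)) \<le> cmod (y j - x k)"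
    by metis
  \<comment> \<open>the diagonal matrix that \<open>U\<^sup>* A U\<close> is close to\<close>
  define D where "D = mat n n (\<lambda>(i, j). if i = j then lam (p j) else 0)"
  have cD: "D \<in> carrier_mat n n" and dD: "diagonal_mat D" by (auto simp: D_def diagonal_mat_def)
  \<comment> \<open>if \<open>?r = 0\<close>, the factor is \<open>0\<close> by the convention for division, and \<open>A\<close> has only one eigenvalue\<close>
  have "frobenius_norm (L * W - W * D) \<le> 2 / (c * ?r) * frobenius_norm G"
  proof (rule frobenius_norm_le_mult[of _ n n])
    fix k j assume kj: "k < n" "j < n"
    have entry: "(L * W - W * D) $$ (k, j) = (lam k - lam (p j)) * W $$ (k, j)"
      using diagonal_mat_mult_index[OF cL L(2) cW kj] mult_diagonal_mat_index[OF cD dD cW kj] kj cL cW cD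
      by (simp add: lam_def D_def algebra_simps del: index_mult_mat(1))
    have "cmod (lam k - lam (p j)) \<le> 2 / (c * ?r) * cmod (y j - x k)"
    proof (cases "lam k = lam (p j)")
      case False
      then have "c * ?r * cmod (lam k - lam (p j)) < \<bar>x k - x (p j)\<bar>"
        using gap[OF kj(1) p[OF kj(2)]] by (simp add: lam_def x_def algebra_simps)
      also have "\<bar>x k - x (p j)\<bar> = cmod ((y j - x (p j)) - (y j - x k))"
        by (simp flip: of_real_diff)
      also have "\<dots> \<le> 2 * cmod (y j - x k)"
        using norm_triangle_ineq4[of "y j - x (p j)" "y j - x k"] p_min[OF kj(2,1)] by linarith
      finally have le: "c * ?r * cmod (lam k - lam (p j)) < 2 * cmod (y j - x k)" .
      have "?r \<noteq> 0"
      proof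
        assume "?r = 0"
        then have "h = 0" "s = 0" by (simp_all add: sum_power2_eq_zero_iff)
        then show False using gap[OF kj(1) p[OF kj(2)]] False by (simp add: lam_def)
      qed
      then have "0 < c * ?r" using c by (simp add: less_le)
      then show ?thesis using le by (simp add: field_simps)
    qed (use c in simp)
    then show "cmod ((L * W - W * D) $$ (k, j)) \<le> 2 / (c * ?r) * cmod (G $$ (k, j))"
      unfolding entry G[OF kj] norm_mult mult.assoc[symmetric] by (rule mult_right_mono) simp
  qed (use cL cW cD cG c in \<open>simp_all add: simps\<close>)
  also have "\<dots> \<le> 2 / (c * ?r) * (?r * frobenius_norm E)"
    using normG c by (intro mult_left_mono) auto
  also have "\<dots> \<le> 2 / c * frobenius_norm E"
    using c by (cases "?r = 0") auto
  finally have main: "frobenius_norm (L * W - W * D) \<le> 2 / c * frobenius_norm E" .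

  have aW: "mat_adjoint W = mat_adjoint U * V"
    using U V by (simp add: W_def mat_adjoint_mult[of _ n n _ n])
  have "mat_adjoint W * (L * W) = mat_adjoint U * ((V * mat_adjoint V) * (A * ((V * mat_adjoint V) * U)))"
    using U V A unfolding aW L by (simp add: W_def simps)
  then have WLW: "mat_adjoint W * (L * W) = mat_adjoint U * A * U"
    using U V A by (simp add: unitary_matD(2)[OF V] simps)
  have "mat_adjoint W * (W * D) = (mat_adjoint W * W) * D"
    using cW cD by (simp add: simps)
  then have WWD: "mat_adjoint W * (W * D) = D" using cD by (simp add: unitary_matD(1)[OF uW cW])
  have "mat_adjoint U * (A + E) * U - D = (mat_adjoint U * A * U - D) + mat_adjoint U * E * U"
  proof -
    have "mat_adjoint U * (A + E) * U = mat_adjoint U * A * U + mat_adjoint U * E * U"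
      using U A E by (simp add: add_mult_distrib_mat[of _ n n _ _ n] mult_add_distrib_mat[of _ n n _ n] simps)
    moreover have "mat_adjoint U * A * U \<in> carrier_mat n n" "mat_adjoint U * E * U \<in> carrier_mat n n"
      using U A E by (simp_all add: simps)
    ultimately show ?thesis using cD by (intro eq_matI) auto
  qed
  moreover have "mat_adjoint U * A * U - D = mat_adjoint W * (L * W - W * D)"
    using cW cL cD by (simp add: mult_minus_distrib_mat[of _ n n _ n] simps WLW WWD)
  ultimately have "mat_adjoint U * (A + E) * U - D = mat_adjoint W * (L * W - W * D) + mat_adjoint U * E * U"
    by simp
  then have "frobenius_norm (offdiag (mat_adjoint U * (A + E) * U))
      \<le> frobenius_norm (mat_adjoint W * (L * W - W * D) + mat_adjoint U * E * U)"
    using frobenius_norm_offdiag_le[OF _ cD dD, of "mat_adjoint U * (A + E) * U"] U AE by (simp add: simps)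
  also have "\<dots> \<le> frobenius_norm (mat_adjoint W * (L * W - W * D)) + frobenius_norm (mat_adjoint U * E * U)"
    by (rule frobenius_norm_add_le[of _ n n]) (use U E cW cL cD in \<open>simp_all add: simps\<close>)
  also have "frobenius_norm (mat_adjoint W * (L * W - W * D)) = frobenius_norm (L * W - W * D)"
    by (rule frobenius_norm_unitary_mult[of _ n]) (use uW cW cL cD in \<open>simp_all add: unitary_mat_adjoint simps\<close>)
  also have "frobenius_norm (mat_adjoint U * E * U) = frobenius_norm E"
    using U E by (simp add: frobenius_norm_mult_unitary[of _ n] frobenius_norm_unitary_mult[of _ n] unitary_mat_adjoint mult_carrier_mat[of _ n n _ n])
  finally show ?thesis using main by (simp add: algebra_simps)
qed

section \<open>The probability of good separation\<close>

text \<open>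
  The left side is the number of ordered pairs of distinct indices times the bound
  \<open>4 c = 8 / (R - 1)\<close> for the failure probability of each, with the factor \<open>1 / (R - 1)\<close> left out.
\<close>

lemma distinct_pairs_failure_bound:
  "8 * (real n * (real n - 1)) \<le> 12 / sqrt pi * real n powr 3.5"
proof (cases "n = 0")
  case False
  then have n: "1 \<le> real n" by simp
  have "6 * real n ^ 3 - 8 * (real n * (real n - 1)) = real n * (6 * (real n - 2/3)\<^sup>2 + 16/3)"
    by (simp add: power2_eq_square power3_eq_cube field_simps)
  also have "\<dots> \<ge> 0" by (intro mult_nonneg_nonneg add_nonneg_nonneg) auto
  finally have "8 * (real n * (real n - 1)) \<le> 6 * real n ^ 3" by linarith
  also have "real n ^ 3 = real n powr 3" using n by (subst powr_numeral) auto
  also have "6 * real n powr 3 \<le> 6 * real n powr 3.5"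
    by (intro mult_left_mono powr_mono n) auto
  also have "\<dots> \<le> 12 / sqrt pi * real n powr 3.5"
  proof (rule mult_right_mono)
    have "sqrt pi \<le> 2" using pi_less_4 by (intro real_le_lsqrt) auto
    then show "6 \<le> 12 / sqrt pi" by (simp add: field_simps)
  qed simp
  finally show ?thesis .
qed simp

theorem corollary3:
  fixes A E :: "complex mat" and n :: nat and R :: real
    and M :: "'a measure" and mu\<^sub>H mu\<^sub>S :: "'a \<Rightarrow> real" and U :: "'a \<Rightarrow> complex mat"
  assumes "A \<in> carrier_mat n n" and "normal_mat A"
    and "E \<in> carrier_mat n n"
    and "prob_space M"
    and "distributed M lborel mu\<^sub>H std_normal_density"
    and "distributed M lborel mu\<^sub>S std_normal_density"
    and "prob_space.indep_var M borel mu\<^sub>H borel mu\<^sub>S"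
    and "\<And>\<omega>. \<omega> \<in> space M \<Longrightarrow> randdiag_output (A + E) (mu\<^sub>H \<omega>) (mu\<^sub>S \<omega>) (U \<omega>)"
    and "R > 1"
  shows "holds_with_prob_at_least M (1 - 12 / sqrt pi * (real n powr 3.5 / (R - 1)))
    (\<lambda>\<omega>. frobenius_norm (offdiag (mat_adjoint (U \<omega>) * (A + E) * U \<omega>))
           \<le> R * frobenius_norm E)"
proof -
  interpret prob_space M by fact
  have [measurable]: "mu\<^sub>H \<in> borel_measurable M" "mu\<^sub>S \<in> borel_measurable M"
    using assms(5,6) by (auto dest!: distributed_measurable)
  obtain V where V: "unitary_mat V" "V \<in> carrier_mat n n" "diagonal_mat (mat_adjoint V * A * V)"
    using normal_mat_unitarily_diagonalizable[OF assms(1,2)] by blast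
  define L where "L = mat_adjoint V * A * V"
  define \<Delta> where "\<Delta> k l = L $$ (k, k) - L $$ (l, l)" for k l
  \<comment> \<open>chosen such that the factor \<open>1 + 2 / c\<close> of the deterministic bound is \<open>R\<close>\<close>
  define c where "c = 2 / (R - 1)"
  have c: "0 < c" and Rc: "1 + 2 / c = R" using assms(9) by (simp_all add: c_def field_simps)
  \<comment> \<open>for equal eigenvalues the bad event below would be the whole space\<close>
  define I where "I = {(k, l). k < n \<and> l < n \<and> L $$ (k, k) \<noteq> L $$ (l, l)}"
  have IS: "I \<subseteq> (SIGMA k:{..<n}. {..<n} - {k})" by (auto simp: I_def)
  then have fin: "finite I" by (rule finite_subset) simp
  have "card I \<le> card (SIGMA k:{..<n}. {..<n} - {k})" by (rule card_mono[OF _ IS]) simp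
  also have "\<dots> = n * (n - 1)" by (simp add: card_Diff_singleton)
  finally have "real (card I) \<le> real (n * (n - 1))" by (simp only: of_nat_le_iff)
  then have card: "real (card I) \<le> real n * (real n - 1)" by (cases n) (auto simp: algebra_simps)
  define bad where "bad q = {\<omega> \<in> space M. \<bar>mu\<^sub>H \<omega> * Re (\<Delta> (fst q) (snd q)) + mu\<^sub>S \<omega> * - Im (\<Delta> (fst q) (snd q))\<bar>
     \<le> c * sqrt ((mu\<^sub>H \<omega>)\<^sup>2 + (mu\<^sub>S \<omega>)\<^sup>2) * sqrt ((Re (\<Delta> (fst q) (snd q)))\<^sup>2 + (- Im (\<Delta> (fst q) (snd q)))\<^sup>2)}" for q
  have "{\<omega> \<in> space M. \<bar>mu\<^sub>H \<omega> * a + mu\<^sub>S \<omega> * b\<bar> \<le> c * sqrt ((mu\<^sub>H \<omega>)\<^sup>2 + (mu\<^sub>S \<omega>)\<^sup>2) * d} \<in> events"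
    for a b d :: real
    by measurable
  then have bad_ev: "bad q \<in> events" for q unfolding bad_def .
  have bad_le: "prob (bad q) \<le> 4 * c" if "q \<in> I" for q
    unfolding bad_def using that c
    by (intro prob_gaussian_small_angle[OF assms(5-7)]) (auto simp: I_def \<Delta>_def complex_eq_iff)
  have "prob (\<Union>q\<in>I. bad q) \<le> (\<Sum>q\<in>I. prob (bad q))"
    using fin bad_ev by (intro finite_measure_subadditive_finite) auto
  also have "\<dots> \<le> real (card I) * (4 * c)" by (rule sum_bounded_above[OF bad_le])
  also have "\<dots> \<le> real n * (real n - 1) * (4 * c)" using card c by (intro mult_right_mono) auto
  also have "\<dots> = 8 * (real n * (real n - 1)) / (R - 1)" by (simp add: c_def)
  also have "\<dots> \<le> 12 / sqrt pi * real n powr 3.5 / (R - 1)"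
    using assms(9) by (intro divide_right_mono distinct_pairs_failure_bound) simp
  finally have Bad: "prob (\<Union>q\<in>I. bad q) \<le> 12 / sqrt pi * (real n powr 3.5 / (R - 1))" by simp
  show ?thesis
    unfolding holds_with_prob_at_least_def
  proof (intro bexI conjI subsetI)
    have "(\<Union>q\<in>I. bad q) \<in> events" using fin bad_ev by auto
    then show "space M - (\<Union>q\<in>I. bad q) \<in> events"
      "1 - 12 / sqrt pi * (real n powr 3.5 / (R - 1)) \<le> prob (space M - (\<Union>q\<in>I. bad q))"
      using Bad by (auto simp: prob_compl)
    fix \<omega> assume \<omega>: "\<omega> \<in> space M - (\<Union>q\<in>I. bad q)"
    have gap: "c * sqrt ((mu\<^sub>H \<omega>)\<^sup>2 + (mu\<^sub>S \<omega>)\<^sup>2) * cmod (L $$ (k, k) - L $$ (l, l))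
       < \<bar>mu\<^sub>H \<omega> * Re (L $$ (k, k) - L $$ (l, l)) - mu\<^sub>S \<omega> * Im (L $$ (k, k) - L $$ (l, l))\<bar>"
      if "k < n" "l < n" "L $$ (k, k) \<noteq> L $$ (l, l)" for k l
    proof -
      have "(k, l) \<in> I" using that by (simp add: I_def)
      then have "\<omega> \<notin> bad (k, l)" using \<omega> by blast
      with \<omega> have "c * sqrt ((mu\<^sub>H \<omega>)\<^sup>2 + (mu\<^sub>S \<omega>)\<^sup>2) * sqrt ((Re (\<Delta> k l))\<^sup>2 + (- Im (\<Delta> k l))\<^sup>2)
          < \<bar>mu\<^sub>H \<omega> * Re (\<Delta> k l) + mu\<^sub>S \<omega> * - Im (\<Delta> k l)\<bar>"
        unfolding bad_def by force
      then show ?thesis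
        unfolding \<Delta>_def[symmetric] cmod_def power2_minus mult_minus_right by simp
    qed
    show "\<omega> \<in> {x \<in> space M. frobenius_norm (offdiag (mat_adjoint (U x) * (A + E) * U x)) \<le> R * frobenius_norm E}"
      using offdiag_randdiag_le[OF assms(1,3) V(1,2) L_def V(3)[folded L_def] assms(8) c gap] \<omega>
      unfolding Rc by blast
  qed
qed

end
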